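(* Let $a$ and $c>0$ be real constants, and let $u_k=u_k(T)$, $x_k=x_k(T)$ ($k\ge0$) be smooth functions of $T$; put $\delta_k=x_k-x_{k-1}$ for $k\ge1$. Let $$\alpha:=a(a-c),\qquad \Delta(\lambda):=1-\alpha\lambda ,$$ and let $\lambda$ be a $T$-independent spectral parameter. Assume $\lambda\neq0$, $\Delta(\lambda)\neq0$, and $\delta_k\neq0$ for all $k$. Then the semi-discrete two-component Hunter--Saxton system $$\text{(S1)}\quad\begin{aligned}\frac{d}{dT}(u_k-u_{k-1})={}&-\frac{u_k-u_{k-1}}{\delta_k}\Bigl((u_k-u_{k-1})+(\delta_k-a)(c-a-\delta_k)\Bigr)\\&+\frac{1}{2\delta_k}\Bigl((u_k-u_{k-1})+(\delta_k-a)(c-a-\delta_k)\Bigr)^2+4u_k\delta_k\\&-c\Bigl((u_k-u_{k-1})+(\delta_k-a)(c-a-\delta_k)\Bigr)-(u_k-u_{k-1})(2\delta_k-c),\end{aligned}$$ $$\text{(S2)}\quad \frac{dx_k}{dT}=-u_k$$ admits the Lax pair $$\Psi_k=U_k(\lambda)\Psi_{k-1},\qquad \frac{\partial\Psi_k}{\partial T}=V_k(\lambda)\Psi_k,$$ where $\Psi_k=\Psi_k(T,\lambda)$ is a two-component vector, $$V_k(\lambda)=\begin{pmatrix}0&1\\ -2u_k+\frac{c^2}{4}+\frac1{2\lambda}&0\end{pmatrix},$$ $$U_k(\lambda)=\frac1{\Delta(\lambda)}\begin{pmatrix}1+\lambda(\delta_k^2+u_k-u_{k-1}-\alpha)&2\lambda\delta_k\\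 \delta_k+\frac{\lambda}{2\delta_k}\bigl((\alpha-\delta_k^2)^2-(u_k-u_{k-1})^2\bigr)&1+\lambda(\delta_k^2-u_k+u_{k-1}-\alpha)\end{pmatrix},$$ in the following sense. The compatibility condition $$\frac{\partial U_k}{\partial T}+U_kV_{k-1}-V_kU_k=0$$ is equivalent to the equation (S1) together with $\dfrac{d\delta_k}{dT}=u_{k-1}-u_k$. Moreover, (S1) and $\dfrac{d\delta_k}{dT}=u_{k-1}-u_k$ for all $k\ge1$, together with $\delta_k=x_k-x_{k-1}$ and the hodograph consistency condition $\dfrac{dx_0}{dT}=-u_0$, are equivalent to the full semi-discrete system (S1) for all $k\ge1$ and (S2) for all $k\ge0$.
   Context: The index $k$ is a discrete spatial site index, $T$ is continuous time, $a$ is a lattice parameter. All relations involving the pair $(k-1,k)$ are for $k\ge1$. *)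

theory Defs
  imports "HOL-Analysis.Analysis"
begin

text \<open>
  Lattice fields are functions \<open>nat \<Rightarrow> real \<Rightarrow> real\<close>, taking the site index \<open>k\<close> first and the time
  \<open>T\<close> second. The time ranges over an open interval \<open>I\<close>, so that solutions that exist only locally in
  time are covered. The spectral parameter, and with it the Lax matrices, are complex; the real case
  is the special case of a real spectral parameter.
\<close>

text \<open>Meaningful for open \<open>I\<close>, where the total operator \<open>deriv\<close> gives the actual iterated derivatives.\<close>
definition smooth_on :: "real set \<Rightarrow> (real \<Rightarrow> real) \<Rightarrow> bool" where
  "smooth_on I f \<longleftrightarrow> (\<forall>n. \<forall>t\<in>I. (deriv ^^ n) f differentiable (at t))"

text \<open>Backward difference \<open>f\<^sub>k - f\<^sub>k\<^sub>-\<^sub>1\<close>; it is used only for \<open>k \<ge> 1\<close>, since \<open>0 - 1 = 0\<close> on \<open>nat\<close>.\<close>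
definition bdiff :: "(nat \<Rightarrow> real \<Rightarrow> real) \<Rightarrow> nat \<Rightarrow> real \<Rightarrow> real" where
  "bdiff f k t = f k t - f (k - 1) t"

text \<open>In what follows \<open>\<delta> = bdiff x\<close>, that is, \<open>\<delta>\<^sub>k = x\<^sub>k - x\<^sub>k\<^sub>-\<^sub>1\<close>.\<close>

definition hs_alpha :: "real \<Rightarrow> real \<Rightarrow> real" where
  "hs_alpha a c = a * (a - c)"

definition hs_Delta :: "real \<Rightarrow> real \<Rightarrow> complex \<Rightarrow> complex" where
  "hs_Delta a c lam = 1 - of_real (hs_alpha a c) * lam"

definition hs_S1_rhs ::
  "real \<Rightarrow> real \<Rightarrow> (nat \<Rightarrow> real \<Rightarrow> real) \<Rightarrow> (nat \<Rightarrow> real \<Rightarrow> real) \<Rightarrow> nat \<Rightarrow> real \<Rightarrow> real" where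
  "hs_S1_rhs a c u x k t =
     (let d = bdiff x k t;
          w = bdiff u k t;
          p = w + (d - a) * (c - a - d)
      in - (w / d) * p + 1 / (2 * d) * p ^ 2 + 4 * u k t * d - c * p - w * (2 * d - c))"

definition hs_S1 ::
  "real set \<Rightarrow> real \<Rightarrow> real \<Rightarrow> (nat \<Rightarrow> real \<Rightarrow> real) \<Rightarrow> (nat \<Rightarrow> real \<Rightarrow> real) \<Rightarrow> nat \<Rightarrow> bool" where
  "hs_S1 I a c u x k \<longleftrightarrow>
     (\<forall>t\<in>I. (bdiff u k has_real_derivative hs_S1_rhs a c u x k t) (at t))"

definition hs_S2 ::
  "real set \<Rightarrow> (nat \<Rightarrow> real \<Rightarrow> real) \<Rightarrow> (nat \<Rightarrow> real \<Rightarrow> real) \<Rightarrow> nat \<Rightarrow> bool" where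
  "hs_S2 I u x k \<longleftrightarrow> (\<forall>t\<in>I. (x k has_real_derivative - u k t) (at t))"

definition hs_delta_eq ::
  "real set \<Rightarrow> (nat \<Rightarrow> real \<Rightarrow> real) \<Rightarrow> (nat \<Rightarrow> real \<Rightarrow> real) \<Rightarrow> nat \<Rightarrow> bool" where
  "hs_delta_eq I u x k \<longleftrightarrow>
     (\<forall>t\<in>I. (bdiff x k has_real_derivative (u (k - 1) t - u k t)) (at t))"

definition hs_V ::
  "real \<Rightarrow> (nat \<Rightarrow> real \<Rightarrow> real) \<Rightarrow> complex \<Rightarrow> nat \<Rightarrow> real \<Rightarrow> complex^2^2" where
  "hs_V c u lam k t =
     vector [vector [0, 1],
             vector [of_real (- 2 * u k t + c ^ 2 / 4) + 1 / (2 * lam), 0]]"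

definition hs_U ::
  "real \<Rightarrow> real \<Rightarrow> (nat \<Rightarrow> real \<Rightarrow> real) \<Rightarrow> (nat \<Rightarrow> real \<Rightarrow> real) \<Rightarrow> complex \<Rightarrow> nat \<Rightarrow> real
    \<Rightarrow> complex^2^2" where
  "hs_U a c u x lam k t =
     (let \<alpha> = complex_of_real (hs_alpha a c);
          d = complex_of_real (bdiff x k t);
          w = complex_of_real (bdiff u k t);
          D = hs_Delta a c lam
      in vector [vector [1 / D * (1 + lam * (d ^ 2 + w - \<alpha>)),
                         1 / D * (2 * lam * d)],
                 vector [1 / D * (d + lam / (2 * d) * ((\<alpha> - d ^ 2) ^ 2 - w ^ 2)),
                         1 / D * (1 + lam * (d ^ 2 - w - \<alpha>))]])"

text \<open>The linear problem \<open>\<Psi>\<^sub>k = U\<^sub>k \<Psi>\<^sub>k\<^sub>-\<^sub>1\<close> (for \<open>k \<ge> 1\<close>), \<open>\<partial>\<Psi>\<^sub>k/\<partial>T = V\<^sub>k \<Psi>\<^sub>k\<close> (for \<open>k \<ge> 0\<close>).\<close>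
definition lax_linear_problem ::
  "real set \<Rightarrow> (nat \<Rightarrow> real \<Rightarrow> complex^2^2) \<Rightarrow> (nat \<Rightarrow> real \<Rightarrow> complex^2^2)
    \<Rightarrow> (nat \<Rightarrow> real \<Rightarrow> complex^2) \<Rightarrow> bool" where
  "lax_linear_problem I U V \<Psi> \<longleftrightarrow>
     (\<forall>k\<ge>1. \<forall>t\<in>I. \<Psi> k t = U k t *v \<Psi> (k - 1) t) \<and>
     (\<forall>k. \<forall>t\<in>I. (\<Psi> k has_vector_derivative (V k t *v \<Psi> k t)) (at t))"

definition lax_compatible ::
  "real set \<Rightarrow> (nat \<Rightarrow> real \<Rightarrow> complex^2^2) \<Rightarrow> (nat \<Rightarrow> real \<Rightarrow> complex^2^2) \<Rightarrow> nat \<Rightarrow> bool" where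
  "lax_compatible I U V k \<longleftrightarrow>
     (\<forall>t\<in>I. vector_derivative (U k) (at t) + U k t ** V (k - 1) t - V k t ** U k t = 0)"

text \<open>
  The left-hand side of the compatibility condition annihilates every solution of the linear problem;
  this is how the condition arises by cross-differentiation.
\<close>
lemma lax_linear_problem_cross_derivative:
  assumes "lax_linear_problem I U V \<Psi>" and "open I" and "t \<in> I" and "k \<ge> 1"
    and "U k differentiable (at t)"
  shows "(vector_derivative (U k) (at t) + U k t ** V (k - 1) t - V k t ** U k t)
           *v \<Psi> (k - 1) t = 0"
proof -
  have bl: "bounded_bilinear ((*v) :: complex^2^2 \<Rightarrow> complex^2 \<Rightarrow> complex^2)"
    unfolding bilinear_conv_bounded_bilinear [symmetric] bilinear_def
    by (intro conjI allI linearI)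
      (simp_all add: matrix_vector_right_distrib matrix_vector_mult_add_rdistrib
        vec_eq_iff matrix_vector_mult_def scaleR_sum_right
        distrib_left distrib_right sum.distrib)
  have U: "(U k has_vector_derivative vector_derivative (U k) (at t)) (at t)"
    using assms(5) by (simp add: vector_derivative_works)
  have P: "(\<Psi> j has_vector_derivative (V j t *v \<Psi> j t)) (at t)" for j
    using assms(1,3) by (auto simp: lax_linear_problem_def)
  have step: "\<Psi> k s = U k s *v \<Psi> (k - 1) s" if "s \<in> I" for s
    using assms(1,4) that by (auto simp: lax_linear_problem_def)
  have "((\<lambda>s. U k s *v \<Psi> (k - 1) s) has_vector_derivative
      (U k t *v (V (k - 1) t *v \<Psi> (k - 1) t)
        + vector_derivative (U k) (at t) *v \<Psi> (k - 1) t)) (at t)"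
    by (rule bounded_bilinear.has_vector_derivative [OF bl U P])
  moreover have "((\<lambda>s. U k s *v \<Psi> (k - 1) s) has_vector_derivative (V k t *v \<Psi> k t)) (at t)"
    by (rule has_vector_derivative_transform_within_open [OF P assms(2,3) step])
  ultimately have "U k t *v (V (k - 1) t *v \<Psi> (k - 1) t)
      + vector_derivative (U k) (at t) *v \<Psi> (k - 1) t = V k t *v (U k t *v \<Psi> (k - 1) t)"
    unfolding step [OF assms(3), symmetric] by (rule vector_derivative_unique_at)
  then show ?thesis
    by (simp add: matrix_vector_mult_add_rdistrib matrix_vector_mult_diff_rdistrib
        matrix_vector_mul_assoc add.commute)
qed

end

theory Submission
  imports Defs
begin

text \<open>
  After clearing the factor \<open>1 / \<Delta>(\<lambda>)\<close>, the upper right entry of the compatibility condition is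
  \<open>2 \<lambda> (\<delta>' + w) = 0\<close> with \<open>w = u\<^sub>k - u\<^sub>k\<^sub>-\<^sub>1\<close>. Once \<open>\<delta>' = - w\<close> is known, the powers of \<open>\<lambda>\<close> other than the
  first cancel in the three remaining entries, and the coefficient of \<open>\<lambda>\<close> in each of them is a multiple of
  \<open>w' - ((\<alpha> - \<delta>\<^sup>2)\<^sup>2 - w\<^sup>2) / (2 \<delta>) - 4 u\<^sub>k \<delta> + c\<^sup>2 \<delta> / 2 + 2 \<delta> w\<close>. This expression does not involve \<open>\<lambda>\<close> and
  vanishes exactly when (S1) holds, because \<open>(\<delta> - a) (c - a - \<delta>) = c \<delta> + (\<alpha> - \<delta>\<^sup>2)\<close>.
\<close>

section \<open>Entrywise differentiation of the matrix \<open>hs_U\<close>\<close>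

lemma has_vector_derivative_vec:
  fixes f :: "real \<Rightarrow> 'a::real_normed_vector^'n"
  assumes "\<And>i. ((\<lambda>t. f t $ i) has_vector_derivative f' $ i) (at x within S)"
  shows "(f has_vector_derivative f') (at x within S)"
  using assms
  unfolding has_vector_derivative_def has_derivative_def
  by (auto intro!: vec_tendstoI bounded_linear_scaleR_left)

lemma has_vector_derivative_matrix_2:
  fixes f :: "real \<Rightarrow> 'a::real_normed_vector^2^2"
  assumes "((\<lambda>t. f t $ 1 $ 1) has_vector_derivative a) (at x within S)"
    and "((\<lambda>t. f t $ 1 $ 2) has_vector_derivative b) (at x within S)"
    and "((\<lambda>t. f t $ 2 $ 1) has_vector_derivative c) (at x within S)"
    and "((\<lambda>t. f t $ 2 $ 2) has_vector_derivative d) (at x within S)"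
  shows "(f has_vector_derivative vector [vector [a, b], vector [c, d]]) (at x within S)"
proof -
  have "((\<lambda>t. f t $ i $ j) has_vector_derivative
      (vector [vector [a, b], vector [c, d]] :: 'a^2^2) $ i $ j) (at x within S)" for i j
    using assms exhaust_2[of i] exhaust_2[of j] by auto
  then show ?thesis
    by (intro has_vector_derivative_vec)
qed

text \<open>Every entry of \<open>hs_U\<close> has this shape with
  \<open>\<kappa> = 1 / hs_Delta a c lam\<close> and real \<open>p\<close>, \<open>q\<close>, so
  real calculus suffices although \<open>lam\<close> is complex.\<close>

lemma has_vector_derivative_complex_combination:
  fixes p q :: "real \<Rightarrow> real" and \<kappa> lam :: complex
  assumes "(p has_real_derivative p') (at t)" "(q has_real_derivative q') (at t)"
  shows "((\<lambda>s. \<kappa> * (of_real (p s) + lam * of_real (q s))) has_vector_derivative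
      \<kappa> * (of_real p' + lam * of_real q')) (at t)"
  by (intro has_vector_derivative_mult_right has_vector_derivative_add
      has_vector_derivative_of_real assms)

text \<open>The rates \<open>w'\<close> and \<open>d'\<close> stay arbitrary: neither evolution
  equation may be presupposed when compatibility is to imply both.\<close>

lemma hs_U_has_vector_derivative:
  fixes a c :: real and lam :: complex
  assumes w: "(bdiff u k has_real_derivative w') (at t)"
    and d: "(bdiff x k has_real_derivative d') (at t)"
    and nz: "bdiff x k t \<noteq> 0"
  defines "\<delta> \<equiv> bdiff x k t" and "\<omega> \<equiv> bdiff u k t" and "\<sigma> \<equiv> hs_alpha a c - (bdiff x k t)\<^sup>2"
    and "\<kappa> \<equiv> 1 / hs_Delta a c lam"
  shows "(hs_U a c u x lam k has_vector_derivative
      vector [vector [\<kappa> * (lam * of_real (2 * \<delta> * d' + w')), \<kappa> * (lam * of_real (2 * d'))],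
              vector [\<kappa> * (of_real d' + lam * of_real
                        (- (2 * \<sigma> * \<delta> * d' + \<omega> * w') / \<delta> - d' * (\<sigma>\<^sup>2 - \<omega>\<^sup>2) / (2 * \<delta>\<^sup>2))),
                      \<kappa> * (lam * of_real (2 * \<delta> * d' - w'))]]) (at t)"
proof (rule has_vector_derivative_matrix_2)
  let ?d = "bdiff x k" and ?w = "bdiff u k" and ?a = "hs_alpha a c"
  have 1: "((\<lambda>s. (?d s)\<^sup>2 + ?w s - ?a) has_real_derivative 2 * \<delta> * d' + w') (at t)"
    and 2: "((\<lambda>s. (?d s)\<^sup>2 - ?w s - ?a) has_real_derivative 2 * \<delta> * d' - w') (at t)"
    by (rule derivative_eq_intros w d refl | simp add: \<delta>_def)+
  have 3: "((\<lambda>s. 2 * ?d s) has_real_derivative 2 * d') (at t)"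
    by (rule derivative_eq_intros d refl)+ simp
  have num: "((\<lambda>s. (?a - (?d s)\<^sup>2)\<^sup>2 - (?w s)\<^sup>2) has_real_derivative
      - 4 * \<sigma> * \<delta> * d' - 2 * \<omega> * w') (at t)"
    by (rule derivative_eq_intros w d refl)+ (simp add: \<delta>_def \<omega>_def \<sigma>_def algebra_simps)
  have quot: "((- 4 * \<sigma> * \<delta> * d' - 2 * \<omega> * w') * (2 * \<delta>) - (\<sigma>\<^sup>2 - \<omega>\<^sup>2) * (2 * d')) / (2 * \<delta> * (2 * \<delta>))
      = - (2 * \<sigma> * \<delta> * d' + \<omega> * w') / \<delta> - d' * (\<sigma>\<^sup>2 - \<omega>\<^sup>2) / (2 * \<delta>\<^sup>2)"
    if "\<delta> \<noteq> 0" for \<delta> \<sigma> \<omega> :: real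
    using that by (simp add: power2_eq_square field_simps)
  have 4: "((\<lambda>s. ((?a - (?d s)\<^sup>2)\<^sup>2 - (?w s)\<^sup>2) / (2 * ?d s)) has_real_derivative
      - (2 * \<sigma> * \<delta> * d' + \<omega> * w') / \<delta> - d' * (\<sigma>\<^sup>2 - \<omega>\<^sup>2) / (2 * \<delta>\<^sup>2)) (at t)"
    using DERIV_divide[OF num 3] quot[of \<delta> \<sigma> \<omega>] nz
    by (simp add: \<delta>_def \<omega>_def \<sigma>_def)
  \<comment> \<open>The summand without \<open>lam\<close> is constant in three entries: 1 on the
    diagonal, 0 in the upper right. In the lower left it is \<open>bdiff x k\<close>.\<close>
  have const: "((\<lambda>s. r) has_real_derivative 0) (at t)" for r :: real
    by simp
  show "((\<lambda>s. hs_U a c u x lam k s $ 1 $ 1) has_vector_derivative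
      \<kappa> * (lam * of_real (2 * \<delta> * d' + w'))) (at t)"
    using has_vector_derivative_complex_combination[OF const[of 1] 1, of \<kappa> lam]
    by (simp add: hs_U_def Let_def \<kappa>_def)
  show "((\<lambda>s. hs_U a c u x lam k s $ 1 $ 2) has_vector_derivative
      \<kappa> * (lam * of_real (2 * d'))) (at t)"
    using has_vector_derivative_complex_combination[OF const[of 0] 3, of \<kappa> lam]
    by (simp add: hs_U_def Let_def \<kappa>_def algebra_simps)
  show "((\<lambda>s. hs_U a c u x lam k s $ 2 $ 1) has_vector_derivative
      \<kappa> * (of_real d' + lam * of_real
        (- (2 * \<sigma> * \<delta> * d' + \<omega> * w') / \<delta> - d' * (\<sigma>\<^sup>2 - \<omega>\<^sup>2) / (2 * \<delta>\<^sup>2)))) (at t)"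
    using has_vector_derivative_complex_combination[OF d 4, of \<kappa> lam]
    by (simp add: hs_U_def Let_def \<kappa>_def)
  show "((\<lambda>s. hs_U a c u x lam k s $ 2 $ 2) has_vector_derivative
      \<kappa> * (lam * of_real (2 * \<delta> * d' - w'))) (at t)"
    using has_vector_derivative_complex_combination[OF const[of 1] 2, of \<kappa> lam]
    by (simp add: hs_U_def Let_def \<kappa>_def)
qed

section \<open>Algebra of the compatibility condition at one instant\<close>

text \<open>In the notation of \<open>hs_S1_rhs\<close>, completing the square turns the first two
  terms into \<open>((p - w) ^ 2 - w ^ 2) / (2 * d)\<close>, where
  \<open>p - w = c * d + (\<alpha> - d ^ 2)\<close>. After expansion the terms in
  \<open>c * w\<close> and \<open>c * (\<alpha> - d ^ 2)\<close> cancel.\<close>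

lemma hs_S1_rhs_eq:
  assumes "bdiff x k t \<noteq> 0"
  shows "hs_S1_rhs a c u x k t =
    ((hs_alpha a c - (bdiff x k t)\<^sup>2)\<^sup>2 - (bdiff u k t)\<^sup>2) / (2 * bdiff x k t)
      + 4 * u k t * bdiff x k t - c\<^sup>2 * bdiff x k t / 2 - 2 * bdiff x k t * bdiff u k t"
  using assms by (simp add: hs_S1_rhs_def hs_alpha_def Let_def power2_eq_square field_simps)

text \<open>
  Here \<open>v\<close>, \<open>w\<close>, \<open>d\<close> and \<open>s\<close> stand for \<open>u\<^sub>k\<^sub>-\<^sub>1\<close>, \<open>u\<^sub>k - u\<^sub>k\<^sub>-\<^sub>1\<close>, \<open>\<delta>\<^sub>k\<close> and \<open>\<alpha> - \<delta>\<^sub>k\<^sup>2\<close>, and \<open>q\<close>, \<open>q'\<close> for the lower left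
  entries of \<open>V\<^sub>k\<close>, \<open>V\<^sub>k\<^sub>-\<^sub>1\<close>. The four equations are the entries of the compatibility condition.
\<close>
lemma lax_entries_iff:
  fixes c d w v s d' w' lam :: "'a::field_char_0"
  assumes "d \<noteq> 0" "lam \<noteq> 0"
  defines "q \<equiv> - 2 * (v + w) + c\<^sup>2 / 4 + 1 / (2 * lam)"
    and "q' \<equiv> - 2 * v + c\<^sup>2 / 4 + 1 / (2 * lam)"
    and "C \<equiv> d + lam / (2 * d) * (s\<^sup>2 - w\<^sup>2)"
  shows "lam * (2 * d * d' + w') + 2 * lam * d * q' - C = 0 \<and>
      lam * (2 * d') + (1 + lam * (w - s)) - (1 + lam * (- w - s)) = 0 \<and>
      d' + lam * (- (2 * s * d * d' + w * w') / d - d' * (s\<^sup>2 - w\<^sup>2) / (2 * d\<^sup>2))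
        + (1 + lam * (- w - s)) * q' - q * (1 + lam * (w - s)) = 0 \<and>
      lam * (2 * d * d' - w') + C - q * (2 * lam * d) = 0 \<longleftrightarrow>
    w' = (s\<^sup>2 - w\<^sup>2) / (2 * d) + 4 * (v + w) * d - c\<^sup>2 * d / 2 - 2 * d * w \<and> d' = - w"
    (is "?A \<and> ?B \<and> ?E \<and> ?F \<longleftrightarrow> ?W \<and> ?D")
proof
  assume *: "?A \<and> ?B \<and> ?E \<and> ?F"
  then have "2 * lam * (d' + w) = 0"
    by (simp add: algebra_simps)
  then have d': ?D
    using assms by (simp add: eq_neg_iff_add_eq_0)
  \<comment> \<open>The entries \<open>?B\<close> and \<open>?F\<close> already force both
    equations. Here the term \<open>1 / (2 * lam)\<close> of \<open>q\<close>, multiplied by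
    \<open>2 * lam * d\<close>, cancels the summand \<open>d\<close> of \<open>C\<close>.\<close>
  have "lam * (2 * d * d' - w') + C - q * (2 * lam * d) =
      lam * ((s\<^sup>2 - w\<^sup>2) / (2 * d) + 4 * (v + w) * d - c\<^sup>2 * d / 2 - 2 * d * w - w')"
    unfolding d' q_def C_def using assms(1,2)
    by (simp add: field_simps)
  with * have ?W
    using assms(2) by simp
  then show "?W \<and> ?D"
    using d' by simp
next
  assume *: "?W \<and> ?D"
  then have W: ?W and D: ?D by auto
  show "?A \<and> ?B \<and> ?E \<and> ?F"
    \<comment> \<open>Under \<open>?D\<close>, the left-hand sides of \<open>?A\<close>,
      \<open>?E\<close>, \<open>?F\<close> are \<open>lam\<close>, \<open>- lam * w / d\<close>,
      \<open>- lam\<close> times the difference of the two sides of \<open>?W\<close>.\<close>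
    unfolding W D q_def q'_def C_def using assms(1,2)
    by (simp add: field_simps power2_eq_square)
qed

lemma matrix_2_eq_0_iff:
  fixes A :: "'a::zero^2^2"
  shows "A = 0 \<longleftrightarrow> A $ 1 $ 1 = 0 \<and> A $ 1 $ 2 = 0 \<and> A $ 2 $ 1 = 0 \<and> A $ 2 $ 2 = 0"
  by (auto simp: vec_eq_iff forall_2)

text \<open>At a fixed time the condition is purely algebraic in the numbers \<open>w'\<close> and
  \<open>d'\<close>. The common factor \<open>\<kappa>\<close> is nonzero and drops out, and the
  resulting complex equations descend to real ones because \<open>of_real\<close> is
  injective.\<close>

lemma hs_lax_compatible_at_iff:
  assumes w: "(bdiff u k has_real_derivative w') (at t)"
    and d: "(bdiff x k has_real_derivative d') (at t)"
    and nz: "bdiff x k t \<noteq> 0" "lam \<noteq> 0" "hs_Delta a c lam \<noteq> 0"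
  shows "vector_derivative (hs_U a c u x lam k) (at t)
        + hs_U a c u x lam k t ** hs_V c u lam (k - 1) t
        - hs_V c u lam k t ** hs_U a c u x lam k t = 0 \<longleftrightarrow>
      w' = hs_S1_rhs a c u x k t \<and> d' = u (k - 1) t - u k t"
    (is "?M = 0 \<longleftrightarrow> _")
proof -
  define \<delta> \<omega> v where "\<delta> = bdiff x k t" and "\<omega> = bdiff u k t" and "v = u (k - 1) t"
  define \<sigma> where "\<sigma> = hs_alpha a c - \<delta>\<^sup>2"
  define \<kappa> where "\<kappa> = 1 / hs_Delta a c lam"
  let ?r = complex_of_real
  define q where "q = - 2 * (?r v + ?r \<omega>) + (?r c)\<^sup>2 / 4 + 1 / (2 * lam)"
  define q' where "q' = - 2 * ?r v + (?r c)\<^sup>2 / 4 + 1 / (2 * lam)"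
  define C where "C = ?r \<delta> + lam / (2 * ?r \<delta>) * ((?r \<sigma>)\<^sup>2 - (?r \<omega>)\<^sup>2)"
  have \<delta>: "\<delta> \<noteq> 0" and \<kappa>: "\<kappa> \<noteq> 0"
    using nz by (auto simp: \<delta>_def \<kappa>_def)
  have uk: "u k t = v + \<omega>"
    by (simp add: v_def \<omega>_def bdiff_def)
  have deriv: "vector_derivative (hs_U a c u x lam k) (at t) =
      vector [vector [\<kappa> * (lam * (2 * ?r \<delta> * ?r d' + ?r w')), \<kappa> * (lam * (2 * ?r d'))],
              vector [\<kappa> * (?r d' + lam * (- (2 * ?r \<sigma> * ?r \<delta> * ?r d' + ?r \<omega> * ?r w') / ?r \<delta>
                        - ?r d' * ((?r \<sigma>)\<^sup>2 - (?r \<omega>)\<^sup>2) / (2 * (?r \<delta>)\<^sup>2))),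
                      \<kappa> * (lam * (2 * ?r \<delta> * ?r d' - ?r w'))]]"
    using vector_derivative_at[OF hs_U_has_vector_derivative[OF w d nz(1), of a c lam]]
    by (simp add: \<delta>_def \<omega>_def \<sigma>_def \<kappa>_def)
  \<comment> \<open>The diagonal is rewritten with
    \<open>\<delta>\<^sup>2 - \<alpha> = - \<sigma>\<close> to match the form in
    \<open>lax_entries_iff\<close>.\<close>
  have U: "hs_U a c u x lam k t =
      vector [vector [\<kappa> * (1 + lam * (?r \<omega> - ?r \<sigma>)), \<kappa> * (2 * lam * ?r \<delta>)],
              vector [\<kappa> * C, \<kappa> * (1 + lam * (- ?r \<omega> - ?r \<sigma>))]]"
    by (simp add: hs_U_def Let_def \<delta>_def \<omega>_def \<sigma>_def \<kappa>_def C_def algebra_simps)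
  have V: "hs_V c u lam k t = vector [vector [0, 1], vector [q, 0]]"
    and V': "hs_V c u lam (k - 1) t = vector [vector [0, 1], vector [q', 0]]"
    by (simp_all add: hs_V_def uk q_def q'_def v_def)
  have "?M $ 1 $ 1 = \<kappa> * (lam * (2 * ?r \<delta> * ?r d' + ?r w') + 2 * lam * ?r \<delta> * q' - C)"
    "?M $ 1 $ 2 = \<kappa> * (lam * (2 * ?r d') + (1 + lam * (?r \<omega> - ?r \<sigma>))
        - (1 + lam * (- ?r \<omega> - ?r \<sigma>)))"
    "?M $ 2 $ 1 = \<kappa> * (?r d' + lam * (- (2 * ?r \<sigma> * ?r \<delta> * ?r d' + ?r \<omega> * ?r w') / ?r \<delta>
          - ?r d' * ((?r \<sigma>)\<^sup>2 - (?r \<omega>)\<^sup>2) / (2 * (?r \<delta>)\<^sup>2))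
        + (1 + lam * (- ?r \<omega> - ?r \<sigma>)) * q' - q * (1 + lam * (?r \<omega> - ?r \<sigma>)))"
    "?M $ 2 $ 2 = \<kappa> * (lam * (2 * ?r \<delta> * ?r d' - ?r w') + C - q * (2 * lam * ?r \<delta>))"
    unfolding deriv U V V'
    by (simp_all add: matrix_matrix_mult_def sum_2) (simp_all add: algebra_simps)
  then have "?M = 0 \<longleftrightarrow>
      lam * (2 * ?r \<delta> * ?r d' + ?r w') + 2 * lam * ?r \<delta> * q' - C = 0 \<and>
      lam * (2 * ?r d') + (1 + lam * (?r \<omega> - ?r \<sigma>)) - (1 + lam * (- ?r \<omega> - ?r \<sigma>)) = 0 \<and>
      ?r d' + lam * (- (2 * ?r \<sigma> * ?r \<delta> * ?r d' + ?r \<omega> * ?r w') / ?r \<delta>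
          - ?r d' * ((?r \<sigma>)\<^sup>2 - (?r \<omega>)\<^sup>2) / (2 * (?r \<delta>)\<^sup>2))
        + (1 + lam * (- ?r \<omega> - ?r \<sigma>)) * q' - q * (1 + lam * (?r \<omega> - ?r \<sigma>)) = 0 \<and>
      lam * (2 * ?r \<delta> * ?r d' - ?r w') + C - q * (2 * lam * ?r \<delta>) = 0"
    unfolding matrix_2_eq_0_iff using \<kappa> by (simp only: mult_eq_0_iff simp_thms)
  also have "\<dots> \<longleftrightarrow> ?r w' = ((?r \<sigma>)\<^sup>2 - (?r \<omega>)\<^sup>2) / (2 * ?r \<delta>) + 4 * (?r v + ?r \<omega>) * ?r \<delta>
      - (?r c)\<^sup>2 * ?r \<delta> / 2 - 2 * ?r \<delta> * ?r \<omega> \<and> ?r d' = - ?r \<omega>"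
    unfolding q_def q'_def C_def using \<delta> nz(2) by (intro lax_entries_iff) auto
  also have "\<dots> \<longleftrightarrow> ?r w' = ?r (hs_S1_rhs a c u x k t) \<and> ?r d' = ?r (u (k - 1) t - u k t)"
    unfolding hs_S1_rhs_eq[OF nz(1)] \<sigma>_def
    by (simp add: uk v_def flip: \<delta>_def \<omega>_def)
  finally show ?thesis
    by (simp only: of_real_eq_iff)
qed

section \<open>From one instant to the whole time interval and lattice\<close>

lemma has_real_derivative_bdiff:
  assumes "(f k has_real_derivative D) (at t)" "(f (k - 1) has_real_derivative D') (at t)"
  shows "(bdiff f k has_real_derivative D - D') (at t)"
  unfolding bdiff_def[abs_def] by (intro DERIV_diff assms)

lemma smooth_on_DERIV_deriv:
  assumes "smooth_on I f" "t \<in> I"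
  shows "(f has_real_derivative deriv f t) (at t)"
proof -
  have "(deriv ^^ 0) f differentiable (at t)"
    using assms unfolding smooth_on_def by blast
  then show ?thesis
    by (simp add: DERIV_deriv_iff_real_differentiable)
qed

lemma hs_lax_compatible_iff:
  assumes smooth: "\<And>j. smooth_on I (u j)" "\<And>j. smooth_on I (x j)"
    and nz: "lam \<noteq> 0" "hs_Delta a c lam \<noteq> 0" "\<And>t. t \<in> I \<Longrightarrow> bdiff x k t \<noteq> 0"
  shows "lax_compatible I (hs_U a c u x lam) (hs_V c u lam) k \<longleftrightarrow>
    hs_S1 I a c u x k \<and> hs_delta_eq I u x k"
proof -
  have "vector_derivative (hs_U a c u x lam k) (at t)
        + hs_U a c u x lam k t ** hs_V c u lam (k - 1) t
        - hs_V c u lam k t ** hs_U a c u x lam k t = 0 \<longleftrightarrow>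
      (bdiff u k has_real_derivative hs_S1_rhs a c u x k t) (at t) \<and>
      (bdiff x k has_real_derivative u (k - 1) t - u k t) (at t)" if "t \<in> I" for t
  proof -
    note w = has_real_derivative_bdiff[where f = u and k = k,
        OF smooth_on_DERIV_deriv[OF smooth(1) that] smooth_on_DERIV_deriv[OF smooth(1) that]]
    note d = has_real_derivative_bdiff[where f = x and k = k,
        OF smooth_on_DERIV_deriv[OF smooth(2) that] smooth_on_DERIV_deriv[OF smooth(2) that]]
    show ?thesis
      unfolding hs_lax_compatible_at_iff[OF w d nz(3)[OF that] nz(1,2)]
      \<comment> \<open>Smoothness supplies both derivatives, so by uniqueness an equation between
        their values is the same as a \<open>has_real_derivative\<close> statement.\<close>
      by (metis w d DERIV_unique)
  qed
  then show ?thesis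
    unfolding lax_compatible_def hs_S1_def hs_delta_eq_def by blast
qed

text \<open>Telescoping: \<open>x (Suc k) = bdiff x (Suc k) + x k\<close> carries the equation from
  site 0 to every site, and differences of neighbouring equations give the converse.\<close>

lemma hs_S2_iff_delta_eq:
  "(\<forall>k\<ge>1. hs_delta_eq I u x k) \<and> hs_S2 I u x 0 \<longleftrightarrow> (\<forall>k. hs_S2 I u x k)"
proof (intro iffI conjI allI impI)
  fix k :: nat
  assume *: "(\<forall>k\<ge>1. hs_delta_eq I u x k) \<and> hs_S2 I u x 0"
  show "hs_S2 I u x k"
  proof (induction k)
    case 0
    then show ?case using * by blast
  next
    case (Suc k)
    have "(x (Suc k) has_real_derivative - u (Suc k) t) (at t)" if "t \<in> I" for t
    proof -
      have "(bdiff x (Suc k) has_real_derivative u k t - u (Suc k) t) (at t)"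
        using * that unfolding hs_delta_eq_def
        by (metis diff_Suc_1 le_add1 plus_1_eq_Suc)
      moreover have "(x k has_real_derivative - u k t) (at t)"
        using Suc.IH that by (simp add: hs_S2_def)
      ultimately have "((\<lambda>s. bdiff x (Suc k) s + x k s) has_real_derivative
          u k t - u (Suc k) t + - u k t) (at t)"
        by (rule DERIV_add)
      then show ?thesis
        by (simp add: bdiff_def)
    qed
    then show ?case
      by (simp add: hs_S2_def)
  qed
next
  fix k :: nat
  assume *: "\<forall>k. hs_S2 I u x k"
  show "hs_delta_eq I u x k"
    unfolding hs_delta_eq_def
  proof
    fix t assume "t \<in> I"
    then have "(x j has_real_derivative - u j t) (at t)" for j
      using * by (simp add: hs_S2_def)
    from has_real_derivative_bdiff[where f = x, OF this this, of k]
    show "(bdiff x k has_real_derivative u (k - 1) t - u k t) (at t)"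
      by simp
  qed
qed simp

theorem proposition1:
  fixes a c :: real and u x :: "nat \<Rightarrow> real \<Rightarrow> real" and I :: "real set" and lam :: complex
  assumes "c > 0"
    and "open I" and "is_interval I" and "I \<noteq> {}"
    and "\<And>k. smooth_on I (u k)"
    and "\<And>k. smooth_on I (x k)"
    and "lam \<noteq> 0" and "hs_Delta a c lam \<noteq> 0"
    and "\<And>k t. k \<ge> 1 \<Longrightarrow> t \<in> I \<Longrightarrow> bdiff x k t \<noteq> 0"
  shows "(\<forall>k\<ge>1. lax_compatible I (hs_U a c u x lam) (hs_V c u lam) k \<longleftrightarrow>
            hs_S1 I a c u x k \<and> hs_delta_eq I u x k) \<and>
         ((\<forall>k\<ge>1. hs_S1 I a c u x k \<and> hs_delta_eq I u x k) \<and> hs_S2 I u x 0 \<longleftrightarrow>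
            (\<forall>k\<ge>1. hs_S1 I a c u x k) \<and> (\<forall>k. hs_S2 I u x k))"
proof
  show "\<forall>k\<ge>1. lax_compatible I (hs_U a c u x lam) (hs_V c u lam) k \<longleftrightarrow>
      hs_S1 I a c u x k \<and> hs_delta_eq I u x k"
    using assms(5-9) by (intro allI impI hs_lax_compatible_iff) auto
  show "(\<forall>k\<ge>1. hs_S1 I a c u x k \<and> hs_delta_eq I u x k) \<and> hs_S2 I u x 0 \<longleftrightarrow>
      (\<forall>k\<ge>1. hs_S1 I a c u x k) \<and> (\<forall>k. hs_S2 I u x k)"
    \<comment> \<open>(S1) stands on both sides, so only the equations for \<open>x\<close> have to
      be compared.\<close>
    using hs_S2_iff_delta_eq[of I u x] by blast
qed

end
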